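(* Let $\{Z_n\}_{n\ge 0}$ be a branching process in an i.i.d. random environment, with $X=\ln m_0$ and $\mu=\mathbb{E}X$ as in the context, such that almost surely every individual has at least one child and $X$ is not almost surely constant (the variance of $X$ may be infinite). Let $p\in(1,2]$ and assume $\mathbb{E}|X-\mu|^p<\infty$. Then for all integers $n_0\ge 0$, $n\ge 1$ and all real $x>0$, $$\mathbb{P}\left(\frac1n\ln\frac{Z_{n_0+n}}{Z_{n_0}}-\mu\ge x\right)\le\frac{C_p}{x^p\,n^{p-1}},$$ where $$C_p=2^{p+1}\,\mathbb{E}|X-\mu|^p+(2p)^pe^{-p}.$$
   Context: Branching process in a random environment: $\xi=(\xi_0,\xi_1,\dots)$ is a sequence of i.i.d. random variables (the environment). Each value of $\xi_n$ determines a probability distribution $p(\xi_n)=\{p_n(i): i\in\mathbb{N}\}$ on $\mathbb{N}=\{0,1,2,\dots\}$ (the offspring law at generation $n$). The process is defined by $Z_0=1$ and $Z_{n+1}=\sum_{i=1}^{Z_n}N_{n,i}$ for $n\ge 0$, where, conditionally on $\xi$, the variables $\{N_{n,i}: n\ge0,i\ge1\}$ are independent and, for each $n$, the $N_{n,i}$ $(i\ge1)$ have common law $p(\xi_n)$. $\mathbb{P}$ is the total (annealed) law, i.e. $\mathbb{P}(dx,d\xi)=\mathbb{P}_\xi(dx)\tau(d\xi)$ with $\mathbb{P}_\xi$ the conditional law given $\xi$ and $\tau$ the law of $\xi$; $\mathbb{E}$ is the corresponding expectation. Put $m_n=\sum_{i\ge0} i\,p_n(i)$ (conditional mean offspring number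 at generation $n$ given $\xi$), $X=\ln m_0$, $\mu=\mathbb{E}X$ (finite). Standing assumption: $p_0(0)=0$ almost surely (the probability of having no children is zero) and $X$ is non-degenerate; hence $Z_n\ge1$ a.s. for all $n$. *)

theory Defs
  imports "HOL-Probability.Probability"
begin

text \<open>
  Conventions: the environment takes values in an arbitrary measurable space \<open>E\<close>; an
  environment value \<open>e\<close> determines the offspring law \<open>law e\<close>; \<open>N n i w\<close> (with \<open>i \<ge> 1\<close>) is the
  number of children of the \<open>i\<close>-th individual of generation \<open>n\<close>.
\<close>

definition env_sigma :: "'a measure \<Rightarrow> 'e measure \<Rightarrow> (nat \<Rightarrow> 'a \<Rightarrow> 'e) \<Rightarrow> 'a measure" where
  "env_sigma M E \<xi> = vimage_algebra (space M) (\<lambda>w n. \<xi> n w) (PiM UNIV (\<lambda>_. E))"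

text \<open>
  The last assumption says that, conditionally on the whole environment \<open>\<xi>\<close>, the variables
  \<open>N n i\<close> (\<open>n \<ge> 0\<close>, \<open>i \<ge> 1\<close>) are independent and \<open>N n i\<close> has law \<open>law (\<xi> n)\<close>. As the \<open>N n i\<close> take
  values in a countable set, it suffices to give the conditional probabilities of the events
  fixing the values of finitely many of them.
\<close>

locale branching_process_iid_env = prob_space M
  for M :: "'a measure" +
  fixes E :: "'e measure"
    and \<xi> :: "nat \<Rightarrow> 'a \<Rightarrow> 'e"
    and law :: "'e \<Rightarrow> nat pmf"
    and N :: "nat \<Rightarrow> nat \<Rightarrow> 'a \<Rightarrow> nat"
  assumes env_indep: "indep_vars (\<lambda>_. E) \<xi> UNIV"
    and env_ident: "\<And>n. distr M E (\<xi> n) = distr M E (\<xi> 0)"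
    and law_measurable: "\<And>k. (\<lambda>e. pmf (law e) k) \<in> borel_measurable E"
    and offspring_measurable: "\<And>n i. i \<ge> 1 \<Longrightarrow> N n i \<in> measurable M (count_space UNIV)"
    and offspring_cond_law:
      "\<And>(J :: (nat \<times> nat) set) (k :: nat \<Rightarrow> nat \<Rightarrow> nat).
         finite J \<Longrightarrow> J \<subseteq> UNIV \<times> {1..} \<Longrightarrow>
         AE w in M.
           real_cond_exp M (env_sigma M E \<xi>)
             (indicator {w' \<in> space M. \<forall>(n, i) \<in> J. N n i w' = k n i}) w
           = (\<Prod>(n, i) \<in> J. pmf (law (\<xi> n w)) (k n i))"

primrec population :: "(nat \<Rightarrow> nat \<Rightarrow> 'a \<Rightarrow> nat) \<Rightarrow> nat \<Rightarrow> 'a \<Rightarrow> nat" where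
  "population N 0 w = 1"
| "population N (Suc n) w = (\<Sum>i = 1..population N n w. N n i w)"

text \<open>
  The series is only meaningful where it converges; a diverging \<open>suminf\<close> has no specified value, so
  almost sure finiteness of the conditional mean has to be assumed separately.
\<close>

definition cond_mean :: "(nat \<Rightarrow> 'a \<Rightarrow> 'e) \<Rightarrow> ('e \<Rightarrow> nat pmf) \<Rightarrow> nat \<Rightarrow> 'a \<Rightarrow> real" where
  "cond_mean \<xi> law n w = (\<Sum>i. real i * pmf (law (\<xi> n w)) i)"

definition log_mean :: "(nat \<Rightarrow> 'a \<Rightarrow> 'e) \<Rightarrow> ('e \<Rightarrow> nat pmf) \<Rightarrow> 'a \<Rightarrow> real" where
  "log_mean \<xi> law w = ln (cond_mean \<xi> law 0 w)"

end

theory Submission imports Defs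
begin

text \<open>
  With \<open>S\<close> the centred sum of the \<open>n\<close> i.i.d. log-means of the generations from \<open>n\<^sub>0\<close> on and \<open>W\<close> the
  ratio \<open>Z (n\<^sub>0 + n) / Z n\<^sub>0\<close> divided by the product of the conditional means of these generations, the
  event says \<open>S + ln W \<ge> n x\<close>, so \<open>S \<ge> n x / 2\<close> or \<open>W \<ge> exp (n x / 2)\<close>. The first alternative is
  controlled by Markov's inequality for the \<open>p\<close>-th moment and the inequality of von Bahr and Esseen
  with constant 2, the second by Markov's inequality and \<open>E W \<le> 1\<close>; finally
  \<open>y\<^sup>p exp (- y / 2)\<close> is maximal at \<open>y = 2 p\<close>.
\<close>

section \<open>Elementary inequalities and the \<open>p\<close>-th moment of independent centred
  sums\<close>

text \<open>After division by \<open>(x + y) powr q\<close> the fractions \<open>x / (x + y)\<close>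
  and \<open>y / (x + y)\<close> lie in [0, 1], where lowering the exponent from 1 to
  \<open>q\<close> can only increase the value, and they add up to 1.\<close>

lemma powr_add_le_add_powr:
  fixes x y q :: real
  assumes "0 \<le> x" "0 \<le> y" "0 \<le> q" "q \<le> 1"
  shows "(x + y) powr q \<le> x powr q + y powr q"
proof (cases "x + y = 0")
  case True
  then show ?thesis using assms by simp
next
  case False
  then have s: "x + y > 0" using assms by simp
  have le: "z / (x + y) \<le> z powr q / (x + y) powr q" if "0 \<le> z" "z \<le> x + y" for z
  proof -
    have "z / (x + y) = (z / (x + y)) powr 1" using that s by simp
    also have "\<dots> \<le> (z / (x + y)) powr q"
      by (rule powr_mono') (use that s assms in auto)
    also have "\<dots> = z powr q / (x + y) powr q"
      using that s by (simp add: powr_divide)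
    finally show ?thesis .
  qed
  have "1 = x / (x + y) + y / (x + y)" using s by (simp flip: add_divide_distrib)
  also have "\<dots> \<le> (x powr q + y powr q) / (x + y) powr q"
    using le[of x] le[of y] assms by (simp add: add_divide_distrib)
  finally show ?thesis using s by (simp add: field_simps)
qed

text \<open>Scale-free case of the expansion proved next. On each of three ranges of
  \<open>t\<close> the modulus has a fixed form, and the difference of the two sides is
  nondecreasing in \<open>\<bar>t\<bar>\<close> with a nonnegative starting value. Since
  \<open>p - 1\<close> lies in (0, 1], subadditivity of that power gives the sign of the derivative
  for \<open>t \<ge> -1\<close>.\<close>

lemma abs_one_plus_powr_le:
  fixes t p :: real
  assumes p: "1 < p" "p \<le> 2"
  shows "\<bar>1 + t\<bar> powr p \<le> 1 + p * t + 2 * \<bar>t\<bar> powr p"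
proof -
  consider "t \<ge> 0" | "- 1 \<le> t" "t < 0" | "t < - 1" by linarith
  then show ?thesis
  proof cases
    case 1
    let ?f = "\<lambda>u::real. 1 + p * u + 2 * u powr p - (1 + u) powr p"
    have "?f 0 \<le> ?f t"
    proof (rule DERIV_nonneg_imp_increasing_open[OF 1])
      fix u :: real assume u: "0 < u" "u < t"
      have "(?f has_real_derivative p + 2 * (p * u powr (p - 1)) - p * (1 + u) powr (p - 1)) (at u)"
        using u by (auto intro!: derivative_eq_intros)
      moreover have "p * (1 + u) powr (p - 1) \<le> p * (1 + u powr (p - 1))"
        using powr_add_le_add_powr[of 1 u "p - 1"] u p by (intro mult_left_mono) auto
      then have "p + 2 * (p * u powr (p - 1)) - p * (1 + u) powr (p - 1) \<ge> p * u powr (p - 1)"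
        by (simp add: algebra_simps)
      then have "p + 2 * (p * u powr (p - 1)) - p * (1 + u) powr (p - 1) \<ge> 0"
        using p by (smt (verit) mult_nonneg_nonneg powr_ge_zero)
      ultimately show "\<exists>y. DERIV ?f u :> y \<and> y \<ge> 0" by blast
    qed (use p in \<open>auto intro!: continuous_intros continuous_on_powr'\<close>)
    then show ?thesis using 1 p by simp
  next
    case 2
    define s where "s = - t"
    have s: "0 \<le> s" "s \<le> 1" using 2 by (auto simp: s_def)
    let ?f = "\<lambda>u::real. 1 - p * u + 2 * u powr p - (1 - u) powr p"
    have "?f 0 \<le> ?f s"
    proof (rule DERIV_nonneg_imp_increasing_open[OF s(1)])
      fix u :: real assume u: "0 < u" "u < s"
      have "(?f has_real_derivative - p + 2 * (p * u powr (p - 1)) + p * (1 - u) powr (p - 1)) (at u)"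
        using u s by (auto intro!: derivative_eq_intros)
      \<comment> \<open>Subadditivity applied to the splitting
        \<open>1 = u + (1 - u)\<close>.\<close>
      moreover have "p * 1 \<le> p * (u powr (p - 1) + (1 - u) powr (p - 1))"
        using powr_add_le_add_powr[of "u" "1 - u" "p - 1"] u s p by (intro mult_left_mono) auto
      then have "- p + 2 * (p * u powr (p - 1)) + p * (1 - u) powr (p - 1) \<ge> p * u powr (p - 1)"
        by (simp add: algebra_simps)
      then have "- p + 2 * (p * u powr (p - 1)) + p * (1 - u) powr (p - 1) \<ge> 0"
        using p by (smt (verit) mult_nonneg_nonneg powr_ge_zero)
      ultimately show "\<exists>y. DERIV ?f u :> y \<and> y \<ge> 0" by blast
    qed (use p s in \<open>auto intro!: continuous_intros continuous_on_powr'\<close>)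
    then show ?thesis using 2 p by (simp add: s_def)
  next
    case 3
    define s where "s = - t"
    have s: "1 \<le> s" using 3 by (auto simp: s_def)
    let ?f = "\<lambda>u::real. 1 - p * u + 2 * u powr p - (u - 1) powr p"
    \<comment> \<open>The starting value \<open>?f 1\<close> is \<open>3 - p\<close>, positive
      because \<open>p \<le> 2\<close>.\<close>
    have "?f 1 \<le> ?f s"
    proof (rule DERIV_nonneg_imp_increasing_open[OF s(1)])
      fix u :: real assume u: "1 < u" "u < s"
      have "(?f has_real_derivative - p + 2 * (p * u powr (p - 1)) - p * (u - 1) powr (p - 1)) (at u)"
        using u s by (auto intro!: derivative_eq_intros)
      moreover have "p * 1 \<le> p * u powr (p - 1)"
        using u p by (intro mult_left_mono ge_one_powr_ge_zero) auto
      moreover have "p * (u - 1) powr (p - 1) \<le> p * u powr (p - 1)"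
        using u p by (intro mult_left_mono powr_mono2) auto
      ultimately show "\<exists>y. DERIV ?f u :> y \<and> y \<ge> 0" by (intro exI conjI) (assumption, linarith)
    qed (use p s in \<open>auto intro!: continuous_intros continuous_on_powr'\<close>)
    then have "(- 1 - t) powr p \<le> 1 + p * t + 2 * (- t) powr p"
      using p by (simp add: s_def minus_diff_commute)
    moreover have "\<bar>1 + t\<bar> = - 1 - t" "\<bar>t\<bar> = - t" using 3 by auto
    ultimately show ?thesis by simp
  qed
qed

text \<open>First-order expansion of the \<open>p\<close>-th power of the modulus around
  \<open>a\<close>: the coefficient of \<open>b\<close> is the derivative at \<open>a\<close>, and
  the remainder costs at most twice the \<open>p\<close>-th power of the increment. By homogeneity
  it reduces to \<open>t = b / a\<close>; for \<open>a = 0\<close> the linear term vanishes.\<close>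

lemma abs_add_powr_le:
  fixes a b p :: real
  assumes p: "1 < p" "p \<le> 2"
  shows "\<bar>a + b\<bar> powr p \<le> \<bar>a\<bar> powr p + p * (sgn a * \<bar>a\<bar> powr (p - 1)) * b + 2 * \<bar>b\<bar> powr p"
proof (cases "a = 0")
  case True
  then show ?thesis by simp
next
  case False
  define t where "t = b / a"
  have b: "b = a * t" using False by (simp add: t_def)
  have sg: "sgn a * a = \<bar>a\<bar>" by (simp add: abs_sgn mult.commute)
  have "\<bar>a\<bar> * \<bar>a\<bar> powr (p - 1) = \<bar>a\<bar> powr p"
    by (subst powr_mult_base) auto
  then have eq: "(sgn a * \<bar>a\<bar> powr (p - 1)) * b = \<bar>a\<bar> powr p * t"
    unfolding b using sg by (metis (no_types, lifting) mult.assoc mult.commute)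
  have "\<bar>a + b\<bar> powr p = \<bar>a\<bar> powr p * \<bar>1 + t\<bar> powr p"
    unfolding b by (subst powr_mult[symmetric]) (auto simp: algebra_simps simp flip: abs_mult)
  also have "\<dots> \<le> \<bar>a\<bar> powr p * (1 + p * t + 2 * \<bar>t\<bar> powr p)"
    by (intro mult_left_mono abs_one_plus_powr_le p) auto
  also have "\<dots> = \<bar>a\<bar> powr p + p * (\<bar>a\<bar> powr p * t) + 2 * \<bar>b\<bar> powr p"
    unfolding b by (simp add: algebra_simps abs_mult powr_mult)
  finally show ?thesis using eq by (simp add: mult.assoc)
qed

text \<open>Induction on the index set. Expanding around the partial sum \<open>S\<close>, the
  linear term is \<open>Y i\<close> times a function of \<open>S\<close>; the factors are
  independent and \<open>Y i\<close> is centred, so its mean is 0. Each new summand thus adds at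
  most \<open>2 * expectation (\<bar>Y i\<bar> powr p)\<close>.\<close>

lemma (in prob_space) von_Bahr_Esseen:
  fixes Y :: "'i \<Rightarrow> 'a \<Rightarrow> real"
  assumes p: "1 < p" "p \<le> 2"
    and I: "finite I" and indep: "indep_vars (\<lambda>_. borel) Y I"
    and int: "\<And>i. i \<in> I \<Longrightarrow> integrable M (Y i)"
    and centered: "\<And>i. i \<in> I \<Longrightarrow> expectation (Y i) = 0"
    and intp: "\<And>i. i \<in> I \<Longrightarrow> integrable M (\<lambda>w. \<bar>Y i w\<bar> powr p)"
  shows "integrable M (\<lambda>w. \<bar>\<Sum>i\<in>I. Y i w\<bar> powr p) \<and>
    expectation (\<lambda>w. \<bar>\<Sum>i\<in>I. Y i w\<bar> powr p) \<le> 2 * (\<Sum>i\<in>I. expectation (\<lambda>w. \<bar>Y i w\<bar> powr p))"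
  using I indep int centered intp
proof (induction I)
  case empty
  then show ?case using p by simp
next
  case (insert i I)
  let ?S = "\<lambda>w. \<Sum>i\<in>I. Y i w"
  have indepI: "indep_vars (\<lambda>_. borel) Y I"
    by (rule indep_vars_subset[OF insert.prems(1)]) auto
  have IH: "integrable M (\<lambda>w. \<bar>?S w\<bar> powr p)"
    "expectation (\<lambda>w. \<bar>?S w\<bar> powr p) \<le> 2 * (\<Sum>i\<in>I. expectation (\<lambda>w. \<bar>Y i w\<bar> powr p))"
    using insert.IH[OF indepI] insert.prems by auto
  have meas [measurable]: "Y j \<in> borel_measurable M" if "j \<in> insert i I" for j
    using insert.prems(2)[OF that] by auto
  then have [measurable]: "Y i \<in> borel_measurable M" "?S \<in> borel_measurable M" by auto
  \<comment> \<open>Derivative of the \<open>p\<close>-th power of the modulus, without its factor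
    \<open>p\<close>.\<close>
  define g where "g = (\<lambda>s::real. sgn s * \<bar>s\<bar> powr (p - 1))"
  have [measurable]: "g \<in> borel_measurable borel" unfolding g_def by measurable
  have "indep_var borel (Y i) borel ?S"
    by (rule indep_vars_sum) (use insert in auto)
  from indep_var_compose[OF this, of "\<lambda>x. x" borel g borel]
  have ind: "indep_var borel (Y i) borel (\<lambda>w. g (?S w))" by (simp add: comp_def)
  have gint: "integrable M (\<lambda>w. g (?S w))"
  proof (rule Bochner_Integration.integrable_bound)
    show "integrable M (\<lambda>w. 1 + \<bar>?S w\<bar> powr p)" using IH(1) by simp
    \<comment> \<open>This growth bound makes \<open>g (?S w)\<close> integrable by the induction
      hypothesis, as the product rule for independent variables requires.\<close>
    have "\<bar>s\<bar> powr (p - 1) \<le> 1 + \<bar>s\<bar> powr p" for s :: real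
    proof (cases "\<bar>s\<bar> \<le> 1")
      case True
      then have "\<bar>s\<bar> powr (p - 1) \<le> 1" using p by (intro powr_le1) auto
      then show ?thesis using powr_ge_zero[of "\<bar>s\<bar>" p] by linarith
    next
      case False
      then have "\<bar>s\<bar> powr (p - 1) \<le> \<bar>s\<bar> powr p" by (intro powr_mono) auto
      then show ?thesis by linarith
    qed
    then show "AE w in M. norm (g (?S w)) \<le> norm (1 + \<bar>?S w\<bar> powr p)"
      by (intro AE_I2) (auto simp: g_def abs_mult abs_sgn_eq powr_ge_zero add_nonneg_nonneg)
  qed measurable
  have Yi: "integrable M (Y i)" "integrable M (\<lambda>w. \<bar>Y i w\<bar> powr p)" "expectation (Y i) = 0"
    using insert.prems by auto
  have cross: "integrable M (\<lambda>w. Y i w * g (?S w))" "expectation (\<lambda>w. Y i w * g (?S w)) = 0"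
    using indep_var_integrable[OF ind Yi(1) gint] indep_var_lebesgue_integral[OF ind Yi(1) gint] Yi(3)
    by auto
  let ?R = "\<lambda>w. \<bar>?S w\<bar> powr p + p * (Y i w * g (?S w)) + 2 * \<bar>Y i w\<bar> powr p"
  have le: "\<bar>?S w + Y i w\<bar> powr p \<le> ?R w" for w
    using abs_add_powr_le[OF p, of "?S w" "Y i w"] by (simp add: g_def mult_ac)
  have Rint: "integrable M ?R" using IH(1) cross(1) Yi(2) by simp
  have int': "integrable M (\<lambda>w. \<bar>?S w + Y i w\<bar> powr p)"
    by (rule Bochner_Integration.integrable_bound[OF Rint])
       (use le in \<open>auto intro!: AE_I2 order_trans[OF le abs_ge_self]\<close>)
  have "expectation (\<lambda>w. \<bar>?S w + Y i w\<bar> powr p) \<le> expectation ?R"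
    by (rule integral_mono[OF int' Rint]) (rule le)
  also have "\<dots> = expectation (\<lambda>w. \<bar>?S w\<bar> powr p) + 2 * expectation (\<lambda>w. \<bar>Y i w\<bar> powr p)"
    using IH(1) cross Yi(2) by simp
  finally show ?case using insert.hyps IH(2) int' by (simp add: add.commute algebra_simps)
qed

text \<open>Logarithmic form of the maximum: the tangent bound \<open>ln z \<le> z - 1\<close> at
  \<open>z = y / (2 * p)\<close>, multiplied by \<open>p\<close> and exponentiated.\<close>

lemma powr_mult_exp_le:
  fixes y p :: real
  assumes "y > 0" "p > 0"
  shows "y powr p * exp (- y / 2) \<le> (2 * p) powr p * exp (- p)"
proof -
  have "ln (y / (2 * p)) \<le> y / (2 * p) - 1"
    using assms by (intro ln_le_minus_one) auto
  then have "p * ln (y / (2 * p)) \<le> p * (y / (2 * p) - 1)"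
    using assms by (intro mult_left_mono) auto
  moreover have "p * (y / (2 * p) - 1) = y / 2 - p"
    using assms by (simp add: field_simps)
  moreover have "p * ln (y / (2 * p)) = p * ln y - p * ln (2 * p)"
    using assms by (simp add: ln_div algebra_simps)
  ultimately have "p * ln y + - y / 2 \<le> p * ln (2 * p) + - p" by simp
  then have "exp (p * ln y + - y / 2) \<le> exp (p * ln (2 * p) + - p)"
    by (simp only: exp_le_cancel_iff)
  then show ?thesis using assms by (simp only: powr_def exp_add) simp
qed

section \<open>Extended means of offspring laws and measurability of the population\<close>

text \<open>Extended-valued, so that no summability assumption is needed.\<close>

definition ennmean :: "nat pmf \<Rightarrow> ennreal" where
  "ennmean q = (\<Sum>i. of_nat i * ennreal (pmf q i))"

lemma ennmean_eq_suminf: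
  assumes "summable (\<lambda>i. real i * pmf q i)"
  shows "ennmean q = ennreal (\<Sum>i. real i * pmf q i)"
proof -
  have "ennmean q = (\<Sum>i. ennreal (real i * pmf q i))"
    by (simp add: ennmean_def ennreal_mult ennreal_of_nat_eq_real_of_nat)
  also have "\<dots> = ennreal (\<Sum>i. real i * pmf q i)"
    using assms by (intro suminf_ennreal2) auto
  finally show ?thesis .
qed

lemma summable_if_ennmean_finite:
  assumes "ennmean q \<noteq> \<top>"
  shows "summable (\<lambda>i. real i * pmf q i)"
proof (rule summable_suminf_not_top)
  show "(\<Sum>i. ennreal (real i * pmf q i)) \<noteq> \<top>"
    using assms by (simp add: ennmean_def ennreal_mult ennreal_of_nat_eq_real_of_nat)
qed auto

text \<open>Without mass at 0, each term \<open>i * pmf q i\<close> dominates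
  \<open>pmf q i\<close>, and the masses sum to 1.\<close>

lemma ennmean_ge_1:
  assumes "pmf q 0 = 0"
  shows "1 \<le> ennmean q"
proof -
  have "1 = (\<integral>\<^sup>+ i. ennreal (pmf q i) \<partial>count_space UNIV)"
    by (rule nn_integral_pmf_eq_1[symmetric])
  also have "\<dots> = (\<Sum>i. ennreal (pmf q i))" by (rule nn_integral_count_space_nat)
  also have "\<dots> \<le> ennmean q"
    unfolding ennmean_def
  proof (intro suminf_le summableI)
    fix i
    show "ennreal (pmf q i) \<le> of_nat i * ennreal (pmf q i)"
    proof (cases i)
      case 0
      then show ?thesis using assms by simp
    next
      case (Suc j)
      have "1 * ennreal (pmf q i) \<le> of_nat i * ennreal (pmf q i)"
        using Suc by (intro mult_right_mono) auto
      then show ?thesis by simp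
    qed
  qed
  finally show ?thesis .
qed

text \<open>The product is 1 except at 0 and \<top>, where it is 0 by the conventions for
  \<open>ennreal\<close>; only the inequality holds throughout.\<close>

lemma ennreal_inverse_mult_self_le_1: "inverse e * e \<le> (1 :: ennreal)"
  by (cases "e = 0 \<or> e = \<top>")
     (auto simp: ennreal_divide_self less_top mult.commute[of "inverse e"]
           simp flip: divide_ennreal_def)

lemma of_nat_eq_suminf_indicator:
  "(of_nat m :: ennreal) = (\<Sum>l. of_nat l * indicator {l} m)"
proof -
  have "(\<Sum>l. of_nat l * indicator {l} m :: ennreal) = (\<Sum>l\<in>{m}. of_nat l * indicator {l} m)"
    by (intro suminf_finite) auto
  then show ?thesis by simp
qed

lemma measurable_indicator_nat:
  fixes f :: "'a \<Rightarrow> nat"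
  assumes "f \<in> measurable S (count_space UNIV)"
  shows "(\<lambda>w. indicator A (f w) :: ennreal) \<in> borel_measurable S"
  using assms by (rule measurable_compose) simp

text \<open>The source \<open>S\<close> is left open so that the lemma applies to the sigma-algebra
  of the past. The random upper limit of the sum is handled by splitting over its countably many
  values.\<close>

lemma measurable_population:
  assumes N: "\<And>j i. j < k \<Longrightarrow> 1 \<le> i \<Longrightarrow> N j i \<in> measurable S (count_space UNIV)"
  shows "j \<le> k \<Longrightarrow> population N j \<in> measurable S (count_space UNIV)"
proof (induction j)
  case 0
  then show ?case by simp
next
  case (Suc j)
  have "(\<lambda>w. \<Sum>i = 1..population N j w. N j i w) \<in> measurable S (count_space UNIV)"
  proof (rule measurable_compose_countable[where f = "\<lambda>m w. \<Sum>i = 1..m. N j i w"])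
    show "(\<lambda>w. \<Sum>i = 1..m. N j i w) \<in> measurable S (count_space UNIV)" for m
      using Suc.prems by (intro measurable_sum_nat N) auto
    show "population N j \<in> measurable S (count_space UNIV)" using Suc by simp
  qed
  then show ?case by simp
qed

section \<open>Environment and offspring history as sub-sigma-algebras\<close>

context branching_process_iid_env
begin

definition offspring_event :: "(nat \<times> nat) set \<Rightarrow> (nat \<Rightarrow> nat \<Rightarrow> nat) \<Rightarrow> 'a set" where
  "offspring_event J c = {w \<in> space M. \<forall>(n, i) \<in> J. N n i w = c n i}"

text \<open>The empty set is included because contradictory prescriptions intersect in it; this
  makes the family a pi-system.\<close>

definition history_generator :: "nat \<Rightarrow> 'a set set" where
  "history_generator k =
     insert {} {offspring_event J c | J c. finite J \<and> J \<subseteq> {..<k} \<times> {1..}}"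

text \<open>The past strictly before the reproduction of generation \<open>k\<close>: it determines
  \<open>population N k\<close> but does not involve \<open>N k i\<close>. The environment is kept
  out of it and enters later integrals through a separate weight.\<close>

definition history :: "nat \<Rightarrow> 'a measure" where
  "history k = sigma (space M) (history_generator k)"

lemma xi_measurable [measurable]: "\<xi> n \<in> measurable M E"
  using env_indep by (auto simp: indep_vars_def)

lemma xi_measurable_env [measurable]: "\<xi> n \<in> measurable (env_sigma M E \<xi>) E"
proof -
  have "(\<lambda>w n. \<xi> n w) \<in> measurable (env_sigma M E \<xi>) (PiM UNIV (\<lambda>_. E))"
    unfolding env_sigma_def
    by (rule measurable_vimage_algebra1)
       (use measurable_space[OF xi_measurable] in \<open>auto simp: space_PiM\<close>)
  from measurable_compose[OF this measurable_component_singleton[of n]]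
  show ?thesis by simp
qed

lemma env_subalgebra: "subalgebra M (env_sigma M E \<xi>)"
proof -
  have "(\<lambda>w. w) \<in> measurable M (env_sigma M E \<xi>)"
    unfolding env_sigma_def
    by (rule measurable_vimage_algebra2)
       (use measurable_space[OF xi_measurable] in
        \<open>auto intro!: measurable_PiM_single' simp: space_PiM\<close>)
  then have id: "(\<lambda>w. w) -` A \<inter> space M \<in> sets M" if "A \<in> sets (env_sigma M E \<xi>)" for A
    using that by (rule measurable_sets)
  have space: "space (env_sigma M E \<xi>) = space M" by (simp add: env_sigma_def)
  have "A \<in> sets M" if A: "A \<in> sets (env_sigma M E \<xi>)" for A
    using id[OF A] sets.sets_into_space[OF A] by (simp add: space Int_absorb2)
  with space show ?thesis by (auto simp: subalgebra_def)
qed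

lemma env_measurable_imp_measurable:
  "f \<in> measurable (env_sigma M E \<xi>) S \<Longrightarrow> f \<in> measurable M S"
  using measurable_from_subalg[OF env_subalgebra] .

lemma ennmean_measurable [measurable]: "(\<lambda>e. ennmean (law e)) \<in> borel_measurable E"
  unfolding ennmean_def using law_measurable by measurable

lemma law_measurable' [measurable]: "(\<lambda>e. pmf (law e) k) \<in> borel_measurable E"
  by (rule law_measurable)

lemma offspring_event_sets [measurable]:
  assumes "finite J" "J \<subseteq> UNIV \<times> {1..}"
  shows "offspring_event J c \<in> sets M"
proof -
  have "{w \<in> space M. \<forall>x \<in> J. N (fst x) (snd x) w = c (fst x) (snd x)} \<in> sets M"
  proof (rule sets.sets_Collect_finite_All[OF _ assms(1)])
    fix x assume "x \<in> J"
    then have [measurable]: "N (fst x) (snd x) \<in> measurable M (count_space UNIV)"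
      using assms(2) by (intro offspring_measurable) auto
    show "{w \<in> space M. N (fst x) (snd x) w = c (fst x) (snd x)} \<in> sets M" by measurable
  qed
  then show ?thesis by (simp add: offspring_event_def case_prod_beta)
qed

text \<open>Integral form of the conditional law of finitely many offspring counts, tested against a
  weight that depends on the environment alone.\<close>

lemma nn_integral_offspring_event:
  assumes J: "finite J" "J \<subseteq> UNIV \<times> {1..}"
    and h [measurable]: "h \<in> borel_measurable (env_sigma M E \<xi>)"
  shows "(\<integral>\<^sup>+ w. h w * indicator (offspring_event J c) w \<partial>M)
    = (\<integral>\<^sup>+ w. h w * (\<Prod>(n, i) \<in> J. ennreal (pmf (law (\<xi> n w)) (c n i))) \<partial>M)"
proof -
  let ?F = "env_sigma M E \<xi>" and ?A = "offspring_event J c"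
  let ?f = "\<lambda>w. \<Prod>(n, i) \<in> J. pmf (law (\<xi> n w)) (c n i)"
  interpret F: finite_measure_subalgebra M ?F
    by unfold_locales (rule env_subalgebra)
  have A [measurable]: "?A \<in> sets M" by (rule offspring_event_sets[OF J])
  have f_F: "?f \<in> borel_measurable ?F"
    unfolding case_prod_beta by measurable
  have f_M [measurable]: "?f \<in> borel_measurable M"
    by (rule env_measurable_imp_measurable[OF f_F])
  have f01: "0 \<le> ?f w" "?f w \<le> 1" for w
    by (auto intro!: prod_nonneg prod_le_1 pmf_le_1 simp: case_prod_beta)
  have ce: "AE w in M. real_cond_exp M ?F (indicator ?A) w = ?f w"
    using offspring_cond_law[OF J, of c] by (simp add: offspring_event_def)
  \<comment> \<open>Passing from the real to the nonnegative conditional expectation permits testing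
    against any extended-valued measurable \<open>h\<close>.\<close>
  have "AE w in M. ennreal (?f w) = nn_cond_exp M ?F (indicator ?A) w"
  proof (rule F.nn_cond_exp_charact)
    fix B assume B: "B \<in> sets ?F"
    then have BM [measurable]: "B \<in> sets M" using env_subalgebra by (auto simp: subalgebra_def)
    have int: "integrable M (\<lambda>w. indicator B w * ?f w)"
      by (rule integrable_const_bound[where B = 1])
         (use f01 in \<open>auto simp: abs_mult indicator_def\<close>)
    have "(\<integral>w\<in>B. indicator ?A w \<partial>M) = (\<integral>w\<in>B. real_cond_exp M ?F (indicator ?A) w \<partial>M)"
      by (rule F.real_cond_exp_intA[OF _ B])
         (rule integrable_real_indicator[OF A], simp add: emeasure_eq_measure)
    also have "\<dots> = (\<integral>w. indicator B w * ?f w \<partial>M)"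
      unfolding set_lebesgue_integral_def
    proof (rule integral_cong_AE)
      show "AE w in M. indicat_real B w *\<^sub>R real_cond_exp M ?F (indicator ?A) w
          = indicat_real B w * ?f w"
        using ce by eventually_elim simp
    qed measurable
    finally have eq: "(\<integral>w\<in>B. indicator ?A w \<partial>M) = (\<integral>w. indicator B w * ?f w \<partial>M)" .
    have "(\<integral>\<^sup>+w\<in>B. indicator ?A w \<partial>M) = (\<integral>\<^sup>+w. ennreal (indicator B w * indicator ?A w) \<partial>M)"
      by (intro nn_integral_cong) (auto split: split_indicator)
    also have "\<dots> = ennreal (\<integral>w. indicator B w * indicator ?A w \<partial>M)"
      by (rule nn_integral_eq_integral)
         (auto intro!: integrable_const_bound[where B = 1] simp: abs_mult indicator_def)
    also have "\<dots> = ennreal (\<integral>w. indicator B w * ?f w \<partial>M)"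
      using eq by (simp add: set_lebesgue_integral_def)
    also have "\<dots> = (\<integral>\<^sup>+w. ennreal (indicator B w * ?f w) \<partial>M)"
      by (rule nn_integral_eq_integral[symmetric, OF int]) (use f01 in auto)
    also have "\<dots> = (\<integral>\<^sup>+w\<in>B. ennreal (?f w) \<partial>M)"
      by (intro nn_integral_cong) (auto split: split_indicator)
    finally show "(\<integral>\<^sup>+w\<in>B. indicator ?A w \<partial>M) = (\<integral>\<^sup>+w\<in>B. ennreal (?f w) \<partial>M)" .
  qed (use f_F in measurable)
  then have "(\<integral>\<^sup>+ w. h w * ennreal (?f w) \<partial>M)
      = (\<integral>\<^sup>+ w. h w * nn_cond_exp M ?F (indicator ?A) w \<partial>M)"
    by (intro nn_integral_cong_AE) auto
  also have "\<dots> = (\<integral>\<^sup>+ w. h w * indicator ?A w \<partial>M)"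
    by (rule F.nn_cond_exp_intg) auto
  finally show ?thesis
    by (simp add: case_prod_beta prod_ennreal)
qed

lemma offspring_event_in_history_generator:
  "finite J \<Longrightarrow> J \<subseteq> {..<k} \<times> {1..} \<Longrightarrow> offspring_event J c \<in> history_generator k"
  unfolding history_generator_def by blast

lemma offspring_event_Un:
  "offspring_event (J \<union> J') c = offspring_event J c \<inter> offspring_event J' c"
  by (auto simp: offspring_event_def)

text \<open>Any point of the event can supply the prescribed values, so two events sharing a point
  acquire a common prescription.\<close>

lemma offspring_event_eq:
  assumes "w \<in> offspring_event J c"
  shows "offspring_event J c = offspring_event J (\<lambda>n i. N n i w)"
proof -
  have "\<forall>q\<in>J. c (fst q) (snd q) = N (fst q) (snd q) w"
    using assms by (auto simp: offspring_event_def)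
  then show ?thesis by (simp add: offspring_event_def case_prod_beta cong: ball_cong)
qed

lemma history_generatorE:
  assumes "A \<in> history_generator k" "A \<noteq> {}"
  obtains J c where "A = offspring_event J c" "finite J" "J \<subseteq> {..<k} \<times> {1..}"
  using assms unfolding history_generator_def by blast

text \<open>If the intersection contains some \<open>w\<close>, the offspring counts of
  \<open>w\<close> itself describe it on the union of the two index sets.\<close>

lemma Int_stable_history_generator: "Int_stable (history_generator k)"
proof (rule Int_stableI)
  fix a b assume a: "a \<in> history_generator k" and b: "b \<in> history_generator k"
  show "a \<inter> b \<in> history_generator k"
  proof (cases "a \<inter> b = {}")
    case True
    then show ?thesis by (simp add: history_generator_def)
  next
    case False
    then obtain w where w: "w \<in> a" "w \<in> b" by blast
    obtain J c where J: "a = offspring_event J c" "finite J" "J \<subseteq> {..<k} \<times> {1..}"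
      using history_generatorE[OF a] w by blast
    obtain J' c' where J': "b = offspring_event J' c'" "finite J'" "J' \<subseteq> {..<k} \<times> {1..}"
      using history_generatorE[OF b] w by blast
    have eq: "a \<inter> b = offspring_event (J \<union> J') (\<lambda>n i. N n i w)"
      unfolding offspring_event_Un
      using offspring_event_eq[OF w(1)[unfolded J(1)]] offspring_event_eq[OF w(2)[unfolded J'(1)]]
      by (simp only: J(1) J'(1))
    show ?thesis
      unfolding eq by (rule offspring_event_in_history_generator) (use J J' in auto)
  qed
qed

lemma history_generator_subset: "history_generator k \<subseteq> Pow (space M)"
  by (auto simp: history_generator_def offspring_event_def)

lemma sets_history: "sets (history k) = sigma_sets (space M) (history_generator k)"
  and space_history: "space (history k) = space M"
  using history_generator_subset by (auto simp: history_def)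

lemma history_subalgebra: "subalgebra M (history k)"
proof -
  have "A \<in> sets M" if A: "A \<in> history_generator k" for A
  proof (cases "A = {}")
    case False
    then obtain J c where J: "A = offspring_event J c" "finite J" "J \<subseteq> {..<k} \<times> {1..}"
      using history_generatorE[OF A] by blast
    then show ?thesis by (simp only:) (rule offspring_event_sets, auto)
  qed simp
  then have "history_generator k \<subseteq> sets M" by blast
  then have "sigma_sets (space M) (history_generator k) \<subseteq> sets M"
    by (rule sets.sigma_sets_subset)
  then show ?thesis by (simp add: subalgebra_def sets_history space_history)
qed

lemma offspring_measurable_history:
  assumes "j < k" "1 \<le> i"
  shows "N j i \<in> measurable (history k) (count_space UNIV)"
proof -
  have "N j i -` {l} \<inter> space M \<in> history_generator k" for l
  proof -
    have "N j i -` {l} \<inter> space M = offspring_event {(j, i)} (\<lambda>_ _. l)"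
      by (auto simp: offspring_event_def)
    then show ?thesis
      using assms by (simp only:) (rule offspring_event_in_history_generator, auto)
  qed
  then show ?thesis
    unfolding measurable_count_space_eq2_countable
    by (auto simp: sets_history space_history intro!: sigma_sets.Basic)
qed

lemma population_measurable_history:
  "j \<le> k \<Longrightarrow> population N j \<in> measurable (history k) (count_space UNIV)"
  by (rule measurable_population[OF offspring_measurable_history])

lemma population_measurable [measurable]: "population N k \<in> measurable M (count_space UNIV)"
  using measurable_from_subalg[OF history_subalgebra population_measurable_history[of k k]] by simp

section \<open>Conditional mean of the next generation\<close>

text \<open>
  Both sides are integrals of \<open>g\<close> with respect to finite measures on \<open>history k\<close>. These agree on the
  generator, where the claim compares the conditional laws of the finite families indexed by
  \<open>insert (k, i) J\<close> and \<open>J\<close>.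
\<close>

lemma nn_integral_next_offspring_eq:
  assumes i: "1 \<le> i"
    and h: "h \<in> borel_measurable (env_sigma M E \<xi>)"
    and fin: "(\<integral>\<^sup>+ w. h w \<partial>M) < \<infinity>"
    and g: "g \<in> borel_measurable (history k)"
  shows "(\<integral>\<^sup>+ w. h w * indicator {l} (N k i w) * g w \<partial>M)
    = (\<integral>\<^sup>+ w. h w * ennreal (pmf (law (\<xi> k w)) l) * g w \<partial>M)"
proof -
  have h_M [measurable]: "h \<in> borel_measurable M" by (rule env_measurable_imp_measurable[OF h])
  have g_M [measurable]: "g \<in> borel_measurable M"
    by (rule measurable_from_subalg[OF history_subalgebra g])
  have N_M [measurable]: "N k i \<in> measurable M (count_space UNIV)"
    by (rule offspring_measurable[OF i])
  define u where "u = (\<lambda>w. h w * indicator {l} (N k i w))"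
  define v where "v = (\<lambda>w. h w * ennreal (pmf (law (\<xi> k w)) l))"
  note [measurable] = measurable_indicator_nat[OF N_M]
  have [measurable]: "u \<in> borel_measurable M" "v \<in> borel_measurable M"
    unfolding u_def v_def by measurable
  have id [measurable]: "(\<lambda>w. w) \<in> measurable M (history k)"
    by (rule measurable_from_subalg[OF history_subalgebra[of k]]) simp
  \<comment> \<open>The image under the identity restricts the measure with the given density to
    \<open>history k\<close>.\<close>
  let ?D = "\<lambda>u. distr (density M u) (history k) (\<lambda>w. w)"
  have em: "emeasure (?D f) A = (\<integral>\<^sup>+ w. f w * indicator A w \<partial>M)"
    if [measurable]: "f \<in> borel_measurable M" and A: "A \<in> sets (history k)" for f A
  proof -
    have [measurable]: "A \<in> sets M" using A history_subalgebra by (auto simp: subalgebra_def)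
    have "emeasure (?D f) A = emeasure (density M f) ((\<lambda>w. w) -` A \<inter> space (density M f))"
      by (rule emeasure_distr) (use A in auto)
    also have "(\<lambda>w. w) -` A \<inter> space (density M f) = A"
      using sets.sets_into_space[OF \<open>A \<in> sets M\<close>] by auto
    finally show ?thesis by (simp add: emeasure_density)
  qed
  have gen: "(\<integral>\<^sup>+ w. u w * indicator A w \<partial>M) = (\<integral>\<^sup>+ w. v w * indicator A w \<partial>M)"
    if A: "A \<in> history_generator k" for A
  proof (cases "A = {}")
    case True
    then show ?thesis by simp
  next
    case False
    then obtain J c where J: "A = offspring_event J c" "finite J" "J \<subseteq> {..<k} \<times> {1..}"
      using history_generatorE[OF A] by blast
    then have J': "J \<subseteq> UNIV \<times> {1..}" and notin: "(k, i) \<notin> J" by auto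
    \<comment> \<open>The prescription is extended by the value \<open>l\<close> at
      \<open>(k, i)\<close>, an index outside \<open>J\<close> because \<open>J\<close> only meets
      generations before \<open>k\<close>.\<close>
    define c' where "c' = c(k := (c k)(i := l))"
    have c': "c' n m = c n m" if "(n, m) \<in> J" for n m
      using that notin by (auto simp: c'_def)
    have c'k: "c' k i = l" by (simp add: c'_def)
    have ev: "u w * indicator A w = h w * indicator (offspring_event (insert (k, i) J) c') w" for w
      using c' c'k by (fastforce simp: u_def J(1) offspring_event_def split: split_indicator)
    have "(\<integral>\<^sup>+ w. u w * indicator A w \<partial>M)
        = (\<integral>\<^sup>+ w. h w * (\<Prod>(n, i) \<in> insert (k, i) J. ennreal (pmf (law (\<xi> n w)) (c' n i))) \<partial>M)"
      unfolding ev by (rule nn_integral_offspring_event) (use J J' i h in auto)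
    also have "\<dots> = (\<integral>\<^sup>+ w. v w * (\<Prod>(n, i) \<in> J. ennreal (pmf (law (\<xi> n w)) (c n i))) \<partial>M)"
    proof (rule nn_integral_cong)
      fix w
      have "(\<Prod>(n, i) \<in> J. ennreal (pmf (law (\<xi> n w)) (c' n i)))
          = (\<Prod>(n, i) \<in> J. ennreal (pmf (law (\<xi> n w)) (c n i)))"
        using c' by (intro prod.cong) auto
      then show "h w * (\<Prod>(n, i) \<in> insert (k, i) J. ennreal (pmf (law (\<xi> n w)) (c' n i)))
          = v w * (\<Prod>(n, i) \<in> J. ennreal (pmf (law (\<xi> n w)) (c n i)))"
        using J(2) notin by (simp add: v_def c'k mult.assoc)
    qed
    also have "\<dots> = (\<integral>\<^sup>+ w. v w * indicator A w \<partial>M)"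
      unfolding J(1)
      by (rule nn_integral_offspring_event[symmetric]) (use J J' h in \<open>auto simp: v_def\<close>)
    finally show ?thesis .
  qed
  have sub: "history_generator k \<subseteq> sets (history k)" by (auto simp: sets_history)
  have "?D u = ?D v"
  proof (rule measure_eqI_generator_eq[OF Int_stable_history_generator history_generator_subset,
        where A = "\<lambda>_. space M"])
    show "emeasure (?D u) A = emeasure (?D v) A" if "A \<in> history_generator k" for A
      using that sub gen by (simp add: em subset_eq)
    \<comment> \<open>The event without constraints is the whole space; with finite total mass it
      provides the exhausting sequence needed for uniqueness of measures on a pi-system.\<close>
    have "space M = offspring_event {} (\<lambda>_ _. 0)" by (simp add: offspring_event_def)
    then have sp: "space M \<in> history_generator k"
      by (simp only:) (rule offspring_event_in_history_generator, auto)
    then show "range (\<lambda>_. space M) \<subseteq> history_generator k" by auto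
    have "emeasure (?D u) (space M) \<le> (\<integral>\<^sup>+ w. h w \<partial>M)"
      using sp sub by (subst em) (auto intro!: nn_integral_mono simp: u_def split: split_indicator)
    then show "emeasure (?D u) (space M) \<noteq> \<infinity>" using fin by auto
  qed (auto simp: sets_history)
  then have "(\<integral>\<^sup>+ w. g w \<partial>?D u) = (\<integral>\<^sup>+ w. g w \<partial>?D v)" by simp
  moreover have "(\<integral>\<^sup>+ w. g w \<partial>?D f) = (\<integral>\<^sup>+ w. f w * g w \<partial>M)"
    if [measurable]: "f \<in> borel_measurable M" for f
    using g by (subst nn_integral_distr) (auto simp: nn_integral_density)
  ultimately show ?thesis by (simp add: u_def v_def)
qed

text \<open>The count is the sum of its values \<open>l\<close> weighted by indicators, so the
  identity for each single value is summed over \<open>l\<close>, with series and integral exchanged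
  by nonnegativity.\<close>

lemma nn_integral_next_offspring:
  assumes i: "1 \<le> i"
    and h: "h \<in> borel_measurable (env_sigma M E \<xi>)"
    and fin: "(\<integral>\<^sup>+ w. h w \<partial>M) < \<infinity>"
    and g: "g \<in> borel_measurable (history k)"
  shows "(\<integral>\<^sup>+ w. h w * of_nat (N k i w) * g w \<partial>M)
    = (\<integral>\<^sup>+ w. h w * ennmean (law (\<xi> k w)) * g w \<partial>M)"
proof -
  have h_M [measurable]: "h \<in> borel_measurable M" by (rule env_measurable_imp_measurable[OF h])
  have g_M [measurable]: "g \<in> borel_measurable M"
    by (rule measurable_from_subalg[OF history_subalgebra g])
  have N_M [measurable]: "N k i \<in> measurable M (count_space UNIV)"
    by (rule offspring_measurable[OF i])
  note [measurable] = measurable_indicator_nat[OF N_M]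
  have "(\<integral>\<^sup>+ w. h w * of_nat (N k i w) * g w \<partial>M)
      = (\<integral>\<^sup>+ w. (\<Sum>l. of_nat l * (h w * indicator {l} (N k i w) * g w)) \<partial>M)"
  proof (rule nn_integral_cong)
    fix w
    show "h w * of_nat (N k i w) * g w = (\<Sum>l. of_nat l * (h w * indicator {l} (N k i w) * g w))"
      by (subst of_nat_eq_suminf_indicator)
         (simp flip: ennreal_suminf_cmult ennreal_suminf_multc add: mult_ac)
  qed
  also have "\<dots> = (\<Sum>l. of_nat l * (\<integral>\<^sup>+ w. h w * indicator {l} (N k i w) * g w \<partial>M))"
    by (subst nn_integral_suminf) (auto simp: nn_integral_cmult)
  also have "\<dots> = (\<Sum>l. of_nat l * (\<integral>\<^sup>+ w. h w * ennreal (pmf (law (\<xi> k w)) l) * g w \<partial>M))"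
    by (simp add: nn_integral_next_offspring_eq[OF assms])
  also have "\<dots> = (\<integral>\<^sup>+ w. (\<Sum>l. of_nat l * (h w * ennreal (pmf (law (\<xi> k w)) l) * g w)) \<partial>M)"
    by (subst nn_integral_suminf) (auto simp: nn_integral_cmult)
  also have "\<dots> = (\<integral>\<^sup>+ w. h w * ennmean (law (\<xi> k w)) * g w \<partial>M)"
    unfolding ennmean_def
    by (rule nn_integral_cong)
       (simp flip: ennreal_suminf_cmult ennreal_suminf_multc add: mult_ac)
  finally show ?thesis .
qed

text \<open>The random number of summands is removed by summing over all individuals with an
  indicator of their existence. That indicator is determined by \<open>history k\<close>, so it is
  absorbed into \<open>g\<close> and the single-individual identity applies to each term.\<close>

lemma nn_integral_next_population:
  assumes h: "h \<in> borel_measurable (env_sigma M E \<xi>)"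
    and fin: "(\<integral>\<^sup>+ w. h w \<partial>M) < \<infinity>"
    and g: "g \<in> borel_measurable (history k)"
  shows "(\<integral>\<^sup>+ w. h w * of_nat (population N (Suc k) w) * g w \<partial>M)
    = (\<integral>\<^sup>+ w. h w * ennmean (law (\<xi> k w)) * of_nat (population N k w) * g w \<partial>M)"
proof -
  have h_M [measurable]: "h \<in> borel_measurable M" by (rule env_measurable_imp_measurable[OF h])
  have g_M [measurable]: "g \<in> borel_measurable M"
    by (rule measurable_from_subalg[OF history_subalgebra g])
  have N_M [measurable]: "N k (Suc i) \<in> measurable M (count_space UNIV)" for i
    by (rule offspring_measurable) simp
  \<comment> \<open>Individuals are numbered from 1 and the series from 0: individual
    \<open>Suc i\<close> exists exactly when \<open>i\<close> is strictly below the population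
    size.\<close>
  let ?g = "\<lambda>i w. indicator {i<..} (population N k w) * g w"
  have g_hist: "?g i \<in> borel_measurable (history k)" for i
    using g measurable_indicator_nat[OF population_measurable_history[of k k]] by measurable
  note [measurable] = measurable_indicator_nat[OF population_measurable]
  have trunc: "(\<Sum>i. f i * indicator {i<..} m) = (\<Sum>i<m. f i)" for f :: "nat \<Rightarrow> ennreal" and m
    by (subst suminf_finite[of "{..<m}"]) auto
  have "(\<integral>\<^sup>+ w. h w * of_nat (population N (Suc k) w) * g w \<partial>M)
      = (\<integral>\<^sup>+ w. (\<Sum>i. h w * of_nat (N k (Suc i) w) * ?g i w) \<partial>M)"
  proof (rule nn_integral_cong)
    fix w
    have "population N (Suc k) w = (\<Sum>i<population N k w. N k (Suc i) w)"
      by (simp add: sum.atLeast1_atMost_eq)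
    then have "of_nat (population N (Suc k) w)
        = (\<Sum>i. of_nat (N k (Suc i) w) * indicator {i<..} (population N k w) :: ennreal)"
      by (simp only: trunc of_nat_sum)
    then show "h w * of_nat (population N (Suc k) w) * g w
        = (\<Sum>i. h w * of_nat (N k (Suc i) w) * ?g i w)"
      by (simp flip: ennreal_suminf_cmult ennreal_suminf_multc add: mult_ac)
  qed
  also have "\<dots> = (\<Sum>i. \<integral>\<^sup>+ w. h w * of_nat (N k (Suc i) w) * ?g i w \<partial>M)"
    by (rule nn_integral_suminf) measurable
  also have "\<dots> = (\<Sum>i. \<integral>\<^sup>+ w. h w * ennmean (law (\<xi> k w)) * ?g i w \<partial>M)"
    by (simp add: nn_integral_next_offspring[OF _ h fin g_hist])
  also have "\<dots> = (\<integral>\<^sup>+ w. (\<Sum>i. h w * ennmean (law (\<xi> k w)) * ?g i w) \<partial>M)"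
    by (rule nn_integral_suminf[symmetric]) measurable
  also have "\<dots> = (\<integral>\<^sup>+ w. h w * ennmean (law (\<xi> k w)) * of_nat (population N k w) * g w \<partial>M)"
  proof (rule nn_integral_cong)
    fix w
    have "of_nat (population N k w) = (\<Sum>i. 1 * indicator {i<..} (population N k w) :: ennreal)"
      by (subst trunc) simp
    then show "(\<Sum>i. h w * ennmean (law (\<xi> k w)) * ?g i w)
        = h w * ennmean (law (\<xi> k w)) * of_nat (population N k w) * g w"
      by (simp flip: ennreal_suminf_cmult ennreal_suminf_multc add: mult_ac)
  qed
  finally show ?thesis .
qed

section \<open>Almost sure bounds on the conditional means\<close>

text \<open>An almost sure property of one environment value depends only on its law, which is the
  same for every generation.\<close>

lemma AE_env_shift:
  assumes [measurable]: "Measurable.pred E P" and ae: "AE w in M. P (\<xi> 0 w)"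
  shows "AE w in M. P (\<xi> n w)"
proof -
  have *: "(AE e in distr M E (\<xi> m). P e) \<longleftrightarrow> (AE w in M. P (\<xi> m w))" for m
    by (rule AE_distr_iff) auto
  have "AE e in distr M E (\<xi> 0). P e" using ae * by blast
  then have "AE e in distr M E (\<xi> n). P e" by (simp only: env_ident[of n])
  then show ?thesis using * by blast
qed

lemma AE_ennmean_ge_1:
  assumes no_extinction: "AE w in M. pmf (law (\<xi> 0 w)) 0 = 0"
  shows "AE w in M. \<forall>n. 1 \<le> ennmean (law (\<xi> n w))"
  unfolding AE_all_countable
proof
  fix n
  show "AE w in M. 1 \<le> ennmean (law (\<xi> n w))"
  proof (rule AE_env_shift)
    show "AE w in M. 1 \<le> ennmean (law (\<xi> 0 w))"
      using no_extinction by eventually_elim (rule ennmean_ge_1)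
  qed measurable
qed

text \<open>Finiteness of \<open>ennmean\<close> is a measurable predicate of the environment value,
  hence carries over from generation 0 to \<open>n\<close>; summability is then recovered from
  it.\<close>

lemma AE_ennmean_eq_cond_mean:
  assumes finite_mean: "AE w in M. summable (\<lambda>i. real i * pmf (law (\<xi> 0 w)) i)"
  shows "AE w in M. \<forall>n. ennmean (law (\<xi> n w)) = ennreal (cond_mean \<xi> law n w)"
  unfolding AE_all_countable
proof
  fix n
  have "AE w in M. ennmean (law (\<xi> n w)) < \<top>"
  proof (rule AE_env_shift)
    show "AE w in M. ennmean (law (\<xi> 0 w)) < \<top>"
      using finite_mean by eventually_elim (simp add: ennmean_eq_suminf)
  qed measurable
  then show "AE w in M. ennmean (law (\<xi> n w)) = ennreal (cond_mean \<xi> law n w)"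
    unfolding cond_mean_def
    by eventually_elim (intro ennmean_eq_suminf summable_if_ennmean_finite, simp add: less_top)
qed

lemma AE_cond_mean_pos:
  assumes "AE w in M. pmf (law (\<xi> 0 w)) 0 = 0"
    and "AE w in M. summable (\<lambda>i. real i * pmf (law (\<xi> 0 w)) i)"
  shows "AE w in M. \<forall>n. 0 < cond_mean \<xi> law n w"
  using AE_ennmean_ge_1[OF assms(1)] AE_ennmean_eq_cond_mean[OF assms(2)]
proof eventually_elim
  fix w assume ge: "\<forall>n. 1 \<le> ennmean (law (\<xi> n w))"
    and eq: "\<forall>n. ennmean (law (\<xi> n w)) = ennreal (cond_mean \<xi> law n w)"
  show "\<forall>n. 0 < cond_mean \<xi> law n w"
  proof
    fix n
    have "0 < ennmean (law (\<xi> n w))" using ge by (metis less_le_trans zero_less_one)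
    then show "0 < cond_mean \<xi> law n w" using eq by simp
  qed
qed

section \<open>Mean and tail of the normalized population\<close>

text \<open>Induction on the number of generations: averaging over the last reproduction produces
  the factor \<open>ennmean (law (\<xi> (k + m) w))\<close>, which the last factor of the weight
  cancels up to an inequality. The factor \<open>1 / Z k\<close> belongs to the past.\<close>

lemma nn_integral_normalized_population_le_1:
  assumes no_extinction: "AE w in M. pmf (law (\<xi> 0 w)) 0 = 0"
  shows "(\<integral>\<^sup>+ w. (\<Prod>j<m. inverse (ennmean (law (\<xi> (k + j) w))))
           * of_nat (population N (k + m) w) * inverse (of_nat (population N k w)) \<partial>M) \<le> 1"
proof (induction m)
  case 0
  have "(\<integral>\<^sup>+ w. of_nat (population N k w) * inverse (of_nat (population N k w)) \<partial>M)
      \<le> (\<integral>\<^sup>+ w. 1 \<partial>M)"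
    using ennreal_inverse_mult_self_le_1
    by (intro nn_integral_mono) (simp add: mult.commute)
  then show ?case by (simp add: emeasure_space_1)
next
  case (Suc m)
  let ?h = "\<lambda>m w. \<Prod>j<m. inverse (ennmean (law (\<xi> (k + j) w)))"
  let ?g = "\<lambda>w. inverse (of_nat (population N k w)) :: ennreal"
  \<comment> \<open>All means are at least 1 almost surely, so the weight is at most 1 and its
    integral is finite, as the averaging step demands.\<close>
  have "(\<integral>\<^sup>+ w. ?h (Suc m) w \<partial>M) \<le> (\<integral>\<^sup>+ w. 1 \<partial>M)"
    using AE_ennmean_ge_1[OF no_extinction]
  proof (intro nn_integral_mono_AE, eventually_elim)
    fix w assume w: "\<forall>n. 1 \<le> ennmean (law (\<xi> n w))"
    have "inverse (ennmean (law (\<xi> n w))) \<le> 1" for n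
    proof -
      let ?e = "ennmean (law (\<xi> n w))"
      have "inverse ?e * 1 \<le> inverse ?e * ?e" using w by (intro mult_left_mono) auto
      also have "\<dots> \<le> 1" by (rule ennreal_inverse_mult_self_le_1)
      finally show ?thesis by simp
    qed
    then show "?h (Suc m) w \<le> 1" by (intro prod_le_1) auto
  qed
  then have fin: "(\<integral>\<^sup>+ w. ?h (Suc m) w \<partial>M) < \<infinity>"
    by (auto simp: emeasure_space_1 intro: le_less_trans[OF _ ennreal_one_less_top])
  have "(\<integral>\<^sup>+ w. ?h (Suc m) w * of_nat (population N (Suc (k + m)) w) * ?g w \<partial>M)
      = (\<integral>\<^sup>+ w. ?h (Suc m) w * ennmean (law (\<xi> (k + m) w))
           * of_nat (population N (k + m) w) * ?g w \<partial>M)"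
  proof (rule nn_integral_next_population[OF _ fin])
    show "?g \<in> borel_measurable (history (k + m))"
      using population_measurable_history[of k "k + m"] by measurable
  qed measurable
  also have "\<dots> \<le> (\<integral>\<^sup>+ w. ?h m w * of_nat (population N (k + m) w) * ?g w \<partial>M)"
  proof (rule nn_integral_mono)
    fix w
    let ?e = "ennmean (law (\<xi> (k + m) w))"
    have "?h m w * (inverse ?e * ?e) * of_nat (population N (k + m) w) * ?g w
        \<le> ?h m w * 1 * of_nat (population N (k + m) w) * ?g w"
      by (intro mult_right_mono mult_left_mono ennreal_inverse_mult_self_le_1) auto
    then show "?h (Suc m) w * ?e * of_nat (population N (k + m) w) * ?g w
        \<le> ?h m w * of_nat (population N (k + m) w) * ?g w"
      by (simp add: mult_ac)
  qed
  also have "\<dots> \<le> 1" by (rule Suc.IH)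
  finally show ?case by simp
qed

text \<open>A given individual has no children with probability equal to the mean of
  \<open>pmf (law (\<xi> n w)) 0\<close>, which is 0. This holds for all of the countably many
  individuals at once, and the first individual of each generation then keeps the line
  alive.\<close>

lemma AE_population_pos:
  assumes no_extinction: "AE w in M. pmf (law (\<xi> 0 w)) 0 = 0"
  shows "AE w in M. \<forall>k. 0 < population N k w"
proof -
  have N0: "AE w in M. N n i w \<noteq> 0" if i: "1 \<le> i" for n i
  proof -
    have [measurable]: "N n i \<in> measurable M (count_space UNIV)"
      by (rule offspring_measurable[OF i])
    have ae: "AE w in M. pmf (law (\<xi> n w)) 0 = 0"
      by (rule AE_env_shift[OF _ no_extinction]) measurable
    have "(\<integral>\<^sup>+ w. 1 * indicator (offspring_event {(n, i)} (\<lambda>_ _. 0)) w \<partial>M)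
        = (\<integral>\<^sup>+ w. 1 * (\<Prod>(n, i) \<in> {(n, i)}. ennreal (pmf (law (\<xi> n w)) 0)) \<partial>M)"
      by (rule nn_integral_offspring_event) (use i in auto)
    also have "\<dots> = (\<integral>\<^sup>+ w. 0 \<partial>M)"
      using ae by (intro nn_integral_cong_AE) auto
    finally have "emeasure M (offspring_event {(n, i)} (\<lambda>_ _. 0)) = 0"
      using i by (simp add: nn_integral_indicator)
    then show ?thesis
      using i by (subst AE_iff_measurable[OF offspring_event_sets[of "{(n, i)}" "\<lambda>_ _. 0"]])
        (auto simp: offspring_event_def)
  qed
  have "AE w in M. \<forall>n i. N n (Suc i) w \<noteq> 0"
    using N0 by (simp add: AE_all_countable)
  then show ?thesis
  proof eventually_elim
    fix w assume w: "\<forall>n i. N n (Suc i) w \<noteq> 0"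
    show "\<forall>k. 0 < population N k w"
    proof
      fix k show "0 < population N k w"
      proof (induction k)
        case (Suc k)
        have "0 < N k 1 w" using w by (metis One_nat_def neq0_conv)
        also have "N k 1 w \<le> (\<Sum>i = 1..population N k w. N k i w)"
          using Suc by (intro member_le_sum) auto
        finally show ?case by simp
      qed simp
    qed
  qed
qed

text \<open>Markov's inequality at level \<open>exp y\<close>. The mean bound is available for the
  extended quantity \<open>?u\<close>, which agrees almost surely with the real ratio once means and
  populations are positive.\<close>

lemma prob_normalized_population_ge_le:
  assumes no_extinction: "AE w in M. pmf (law (\<xi> 0 w)) 0 = 0"
    and finite_mean: "AE w in M. summable (\<lambda>i. real i * pmf (law (\<xi> 0 w)) i)"
  shows "prob {w \<in> space M. exp y \<le> real (population N (k + m) w) / real (population N k w)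
           / (\<Prod>j<m. cond_mean \<xi> law (k + j) w)} \<le> exp (- y)"
proof -
  let ?u = "\<lambda>w. (\<Prod>j<m. inverse (ennmean (law (\<xi> (k + j) w))))
    * of_nat (population N (k + m) w) * inverse (of_nat (population N k w)) :: ennreal"
  let ?W = "\<lambda>w. real (population N (k + m) w) / real (population N k w)
    / (\<Prod>j<m. cond_mean \<xi> law (k + j) w)"
  have [measurable]: "cond_mean \<xi> law n \<in> borel_measurable M" for n
    unfolding cond_mean_def by measurable
  have eq: "AE w in M. ennreal (?W w) = ?u w"
    using AE_ennmean_eq_cond_mean[OF finite_mean] AE_cond_mean_pos[OF no_extinction finite_mean]
      AE_population_pos[OF no_extinction]
  proof eventually_elim
    fix w assume mean: "\<forall>n. ennmean (law (\<xi> n w)) = ennreal (cond_mean \<xi> law n w)"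
      and cpos: "\<forall>n. 0 < cond_mean \<xi> law n w" and pos: "\<forall>k. 0 < population N k w"
    have "?u w = (\<Prod>j<m. ennreal (inverse (cond_mean \<xi> law (k + j) w)))
        * ennreal (real (population N (k + m) w)) * ennreal (inverse (real (population N k w)))"
      using pos cpos by (simp add: mean inverse_ennreal ennreal_of_nat_eq_real_of_nat)
    also have "\<dots> = ennreal ((\<Prod>j<m. inverse (cond_mean \<xi> law (k + j) w))
        * real (population N (k + m) w) * inverse (real (population N k w)))"
      using cpos by (simp add: prod_ennreal less_imp_le ennreal_mult prod_nonneg)
    also have "\<dots> = ennreal (?W w)"
      using prod_inversef[of "\<lambda>j. cond_mean \<xi> law (k + j) w" "{..<m}"]
      by (simp add: comp_def divide_inverse mult_ac)
    finally show "ennreal (?W w) = ?u w" by simp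
  qed
  have "emeasure M {w \<in> space M. exp y \<le> ?W w}
      \<le> emeasure M {w \<in> space M. 1 \<le> ennreal (exp (- y)) * ennreal (?W w)}"
  proof (rule emeasure_mono)
    show "{w \<in> space M. exp y \<le> ?W w} \<subseteq> {w \<in> space M. 1 \<le> ennreal (exp (- y)) * ennreal (?W w)}"
    proof safe
      fix w assume "exp y \<le> ?W w"
      then have "exp (- y) * exp y \<le> exp (- y) * ?W w" by (intro mult_left_mono) auto
      then have "1 \<le> exp (- y) * ?W w" by (simp flip: exp_add)
      then have "ennreal 1 \<le> ennreal (exp (- y) * ?W w)" by (rule ennreal_leI)
      also have "\<dots> = ennreal (exp (- y)) * ennreal (?W w)" by (rule ennreal_mult') simp
      finally show "1 \<le> ennreal (exp (- y)) * ennreal (?W w)" by (simp only: ennreal_1)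
    qed
  qed measurable
  also have "\<dots> \<le> ennreal (exp (- y)) * (\<integral>\<^sup>+ w. ennreal (?W w) * indicator (space M) w \<partial>M)"
    by (rule nn_integral_Markov_inequality) measurable
  also have "(\<integral>\<^sup>+ w. ennreal (?W w) * indicator (space M) w \<partial>M) = (\<integral>\<^sup>+ w. ennreal (?W w) \<partial>M)"
    by (intro nn_integral_cong) simp
  also have "\<dots> = (\<integral>\<^sup>+ w. ?u w \<partial>M)"
    by (rule nn_integral_cong_AE[OF eq])
  also have "ennreal (exp (- y)) * \<dots> \<le> ennreal (exp (- y)) * 1"
    by (intro mult_left_mono nn_integral_normalized_population_le_1 no_extinction) auto
  finally show ?thesis by (simp add: emeasure_eq_measure)
qed

text \<open>Off a null set all populations and means are positive, so the logarithm of the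
  normalized ratio splits into a difference.\<close>

lemma AE_ln_population_ratio:
  assumes no_extinction: "AE w in M. pmf (law (\<xi> 0 w)) 0 = 0"
    and finite_mean: "AE w in M. summable (\<lambda>i. real i * pmf (law (\<xi> 0 w)) i)"
  shows "AE w in M. \<forall>y. ln (real (population N (k + m) w) / real (population N k w))
      - (\<Sum>j<m. ln (cond_mean \<xi> law (k + j) w)) \<ge> y \<longrightarrow>
      exp y \<le> real (population N (k + m) w) / real (population N k w)
           / (\<Prod>j<m. cond_mean \<xi> law (k + j) w)"
  using AE_cond_mean_pos[OF no_extinction finite_mean] AE_population_pos[OF no_extinction]
proof eventually_elim
  fix w assume cpos: "\<forall>n. 0 < cond_mean \<xi> law n w" and pos: "\<forall>k. 0 < population N k w"
  let ?R = "real (population N (k + m) w) / real (population N k w)"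
  let ?P = "\<Prod>j<m. cond_mean \<xi> law (k + j) w"
  have P: "0 < ?P" using cpos by (intro prod_pos) auto
  have R: "0 < ?R" using pos by simp
  have "ln ?P = (\<Sum>j<m. ln (cond_mean \<xi> law (k + j) w))"
    using cpos by (intro ln_prod) (auto simp: less_imp_neq[symmetric])
  then have "ln (?R / ?P) = ln ?R - (\<Sum>j<m. ln (cond_mean \<xi> law (k + j) w))"
    using ln_divide_pos[OF R P] by simp
  then show "\<forall>y. ln ?R - (\<Sum>j<m. ln (cond_mean \<xi> law (k + j) w)) \<ge> y \<longrightarrow> exp y \<le> ?R / ?P"
    using R P by (metis divide_pos_pos exp_le_cancel_iff exp_ln)
qed

end

section \<open>Combination of the two tail bounds\<close>

theorem theorem2p4:
  fixes M :: "'a measure" and E :: "'e measure"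
    and \<xi> :: "nat \<Rightarrow> 'a \<Rightarrow> 'e" and law :: "'e \<Rightarrow> nat pmf"
    and N :: "nat \<Rightarrow> nat \<Rightarrow> 'a \<Rightarrow> nat"
    and X :: "'a \<Rightarrow> real" and \<mu> p x C :: real and n\<^sub>0 n :: nat
  defines "X \<equiv> log_mean \<xi> law"
    and "\<mu> \<equiv> integral\<^sup>L M X"
    and "C \<equiv> 2 powr (p + 1) * integral\<^sup>L M (\<lambda>w. \<bar>X w - \<mu>\<bar> powr p) + (2 * p) powr p * exp (- p)"
  assumes "branching_process_iid_env M E \<xi> law N"
    and "AE w in M. summable (\<lambda>i. real i * pmf (law (\<xi> 0 w)) i)"
    and "integrable M X"
    and "AE w in M. pmf (law (\<xi> 0 w)) 0 = 0"
    and "\<not> (\<exists>c. AE w in M. X w = c)"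
    and "1 < p" and "p \<le> 2"
    and "integrable M (\<lambda>w. \<bar>X w - \<mu>\<bar> powr p)"
    and "n \<ge> 1" and "x > 0"
  shows "measure M {w \<in> space M.
           1 / real n * ln (real (population N (n\<^sub>0 + n) w) / real (population N n\<^sub>0 w)) - \<mu> \<ge> x}
         \<le> C / (x powr p * real n powr (p - 1))"
proof -
  interpret branching_process_iid_env M E \<xi> law N by fact
  note finite_mean = \<open>AE w in M. summable (\<lambda>i. real i * pmf (law (\<xi> 0 w)) i)\<close>
  note no_extinction = \<open>AE w in M. pmf (law (\<xi> 0 w)) 0 = 0\<close>
  note p = \<open>1 < p\<close> \<open>p \<le> 2\<close>
  define K where "K = expectation (\<lambda>w. \<bar>X w - \<mu>\<bar> powr p)"
  \<comment> \<open>Writing the centred log-mean as a measurable function of a single environment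
    value lets independence and the common law pass from \<open>\<xi>\<close> to
    \<open>Y\<close>.\<close>
  define G where "G = (\<lambda>e. ln (\<Sum>i. real i * pmf (law e) i) - \<mu>)"
  have G [measurable]: "G \<in> borel_measurable E" unfolding G_def by measurable
  define Y where "Y = (\<lambda>j w. G (\<xi> j w))"
  have Y: "Y j w = ln (cond_mean \<xi> law j w) - \<mu>" for j w
    by (simp add: Y_def G_def cond_mean_def)
  have Y0: "Y 0 = (\<lambda>w. X w - \<mu>)"
    by (simp add: Y fun_eq_iff X_def log_mean_def)
  have shift_int: "integrable M (\<lambda>w. f (Y j w))"
    if "f \<in> borel_measurable borel" "integrable M (\<lambda>w. f (Y 0 w))"
    for j and f :: "real \<Rightarrow> real"
    using that integrable_distr_eq[of "\<xi> j" M E "\<lambda>e. f (G e)"]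
      integrable_distr_eq[of "\<xi> 0" M E "\<lambda>e. f (G e)"] env_ident[of j]
    by (simp add: Y_def)
  have shift_exp: "expectation (\<lambda>w. f (Y j w)) = expectation (\<lambda>w. f (Y 0 w))"
    if "f \<in> borel_measurable borel" for j and f :: "real \<Rightarrow> real"
    using that integral_distr[of "\<xi> j" M E "\<lambda>e. f (G e)"]
      integral_distr[of "\<xi> 0" M E "\<lambda>e. f (G e)"] env_ident[of j]
    by (simp add: Y_def)
  have intX: "integrable M (\<lambda>w. Y 0 w)" and expX: "expectation (\<lambda>w. Y 0 w) = 0"
    using \<open>integrable M X\<close> by (simp_all add: Y0 \<mu>_def prob_space)
  let ?I = "{n\<^sub>0..<n\<^sub>0 + n}"
  define S where "S = (\<lambda>w. \<Sum>j\<in>?I. Y j w)"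
  have [measurable]: "Y j \<in> borel_measurable M" for j unfolding Y_def by measurable
  have [measurable]: "S \<in> borel_measurable M" unfolding S_def by measurable
  have "indep_vars (\<lambda>_. borel) Y UNIV"
    unfolding Y_def by (rule indep_vars_compose2[OF env_indep]) measurable
  then have indep: "indep_vars (\<lambda>_. borel) Y ?I" by (rule indep_vars_subset) auto
  have Sp: "integrable M (\<lambda>w. \<bar>S w\<bar> powr p)"
    "expectation (\<lambda>w. \<bar>S w\<bar> powr p) \<le> 2 * (\<Sum>j\<in>?I. expectation (\<lambda>w. \<bar>Y j w\<bar> powr p))"
    unfolding S_def
    using von_Bahr_Esseen[OF p _ indep] shift_int[of "\<lambda>y. y"] shift_exp[of "\<lambda>y. y"] intX expX
      shift_int[of "\<lambda>y. \<bar>y\<bar> powr p"] \<open>integrable M (\<lambda>w. \<bar>X w - \<mu>\<bar> powr p)\<close>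
    by (simp_all add: Y0)
  have "expectation (\<lambda>w. \<bar>Y j w\<bar> powr p) = K" for j
    using shift_exp[of "\<lambda>y. \<bar>y\<bar> powr p" j] by (simp add: Y0 K_def)
  with Sp(2) have SK: "expectation (\<lambda>w. \<bar>S w\<bar> powr p) \<le> 2 * (real n * K)" by simp
  \<comment> \<open>The total excess \<open>n * x\<close> is split equally between the sum
    \<open>S\<close> and the logarithm of the normalized ratio.\<close>
  define a where "a = real n * x / 2"
  have n0: "0 < real n" and a0: "0 < a" using \<open>n \<ge> 1\<close> \<open>x > 0\<close> by (simp_all add: a_def)
  let ?R = "\<lambda>w. real (population N (n\<^sub>0 + n) w) / real (population N n\<^sub>0 w)"
  let ?P = "\<lambda>w. \<Prod>j<n. cond_mean \<xi> law (n\<^sub>0 + j) w"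
  define A where "A = {w \<in> space M. 1 / real n * ln (?R w) - \<mu> \<ge> x}"
  \<comment> \<open>Stated with \<open>p\<close>-th powers to suit Markov's inequality; since
    \<open>a > 0\<close>, it contains the event \<open>a \<le> S w\<close>.\<close>
  define A1 where "A1 = {w \<in> space M. \<bar>S w\<bar> powr p \<ge> a powr p}"
  define A2 where "A2 = {w \<in> space M. exp a \<le> ?R w / ?P w}"
  have [measurable]: "cond_mean \<xi> law j \<in> borel_measurable M" for j
    unfolding cond_mean_def by measurable
  have sets: "A1 \<in> sets M" "A2 \<in> sets M" unfolding A1_def A2_def by measurable
  have "prob A1 \<le> expectation (\<lambda>w. \<bar>S w\<bar> powr p) / a powr p"
    unfolding A1_def
    by (rule integral_Markov_inequality_measure[OF Sp(1) sets.empty_sets]) (use a0 in auto)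
  also have "\<dots> \<le> 2 * (real n * K) / a powr p" using SK by (intro divide_right_mono) auto
  finally have A1: "prob A1 \<le> 2 * (real n * K) / a powr p" .
  have A2: "prob A2 \<le> exp (- a)"
    unfolding A2_def by (rule prob_normalized_population_ge_le[OF no_extinction finite_mean])
  have "AE w in M. w \<in> A \<longrightarrow> w \<in> A1 \<union> A2"
    using AE_ln_population_ratio[OF no_extinction finite_mean, of n\<^sub>0 n] AE_space
  proof eventually_elim
    fix w
    assume w: "\<forall>y. ln (?R w) - (\<Sum>j<n. ln (cond_mean \<xi> law (n\<^sub>0 + j) w)) \<ge> y \<longrightarrow> exp y \<le> ?R w / ?P w"
      and "w \<in> space M"
    have "(\<Sum>j<n. ln (cond_mean \<xi> law (n\<^sub>0 + j) w)) = (\<Sum>j\<in>?I. ln (cond_mean \<xi> law j w))"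
      by (simp add: sum.atLeastLessThan_shift_0[of _ n\<^sub>0] atLeast0LessThan)
    then have sum: "(\<Sum>j<n. ln (cond_mean \<xi> law (n\<^sub>0 + j) w)) = S w + real n * \<mu>"
      by (simp add: S_def Y sum_subtractf)
    show "w \<in> A \<longrightarrow> w \<in> A1 \<union> A2"
    proof
      assume "w \<in> A"
      then have "x \<le> 1 / real n * ln (?R w) - \<mu>" by (simp add: A_def)
      then have "real n * x \<le> real n * (1 / real n * ln (?R w) - \<mu>)"
        using n0 by (intro mult_left_mono) auto
      then have le: "2 * a \<le> ln (?R w) - real n * \<mu>"
        using n0 by (simp add: a_def right_diff_distrib)
      show "w \<in> A1 \<union> A2"
      proof (cases "a \<le> S w")
        case True
        then have "a powr p \<le> \<bar>S w\<bar> powr p" using a0 p by (intro powr_mono2) auto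
        then show ?thesis using \<open>w \<in> space M\<close> by (simp add: A1_def)
      next
        case False
        \<comment> \<open>The excess is at least \<open>2 * a\<close> in total and
          \<open>S w < a\<close>, so the logarithm of the normalized ratio carries the rest.\<close>
        then have "a \<le> ln (?R w) - (S w + real n * \<mu>)" using le by simp
        then have "exp a \<le> ?R w / ?P w" using w by (simp only: sum)
        then show ?thesis using \<open>w \<in> space M\<close> by (simp add: A2_def)
      qed
    qed
  qed
  then have "prob A \<le> prob (A1 \<union> A2)" using sets by (intro finite_measure_mono_AE) auto
  also have "\<dots> \<le> prob A1 + prob A2" using sets by (intro measure_Un_le)
  also have "\<dots> \<le> 2 * (real n * K) / a powr p + exp (- a)" using A1 A2 by simp
  also have "2 * (real n * K) / a powr p = 2 powr (p + 1) * K / (x powr p * real n powr (p - 1))"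
  proof -
    \<comment> \<open>One factor \<open>real n\<close> is split off to cancel the number of
      summands; the \<open>2 powr p\<close> from halving and the moment constant 2 give
      \<open>2 powr (p + 1)\<close>.\<close>
    have ap: "a powr p = real n * (real n powr (p - 1) * x powr p) / 2 powr p"
      using n0 \<open>x > 0\<close> powr_mult_base[of "real n" "p - 1"]
      by (simp add: a_def powr_divide powr_mult)
    show ?thesis unfolding ap using n0 \<open>x > 0\<close> by (simp add: powr_add field_simps)
  qed
  also have "exp (- a) \<le> (2 * p) powr p * exp (- p) / (x powr p * real n powr (p - 1))"
  proof -
    let ?y = "real n * x"
    have y: "?y > 0" using n0 \<open>x > 0\<close> by simp
    \<comment> \<open>As \<open>n \<ge> 1\<close>, raising the exponent of \<open>n\<close> to
      \<open>p\<close> yields the \<open>p\<close>-th power of \<open>?y\<close>, while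
      \<open>a = ?y / 2\<close>; the elementary maximum then applies.\<close>
    have "x powr p * real n powr (p - 1) \<le> x powr p * real n powr p"
      using \<open>n \<ge> 1\<close> by (intro mult_left_mono powr_mono) auto
    also have "\<dots> = ?y powr p" using n0 \<open>x > 0\<close> by (simp add: powr_mult)
    finally have "x powr p * real n powr (p - 1) * exp (- a) \<le> ?y powr p * exp (- ?y / 2)"
      by (simp add: a_def)
    also have "\<dots> \<le> (2 * p) powr p * exp (- p)" using y p by (intro powr_mult_exp_le) auto
    finally show ?thesis using n0 \<open>x > 0\<close> by (simp add: field_simps)
  qed
  finally show ?thesis
    by (simp add: A_def C_def K_def add_divide_distrib)
qed

end
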